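(* Let $A(x),B(x)$ be as in the context, let $r>0$ be a given real number with $\mathcal{B}_r\subseteq\mathbb{X}$, and let $\bar{\mathcal{G}}$ be the finite vertex set defined in the context. Suppose that there exist a symmetric matrix $\Gamma\in\mathbb{R}^{n\times n}$ with $\Gamma\succ 0$, a real number $\epsilon_\Gamma>0$ and a matrix $Y\in\mathbb{R}^{m\times n}$ such that $$\begin{bmatrix} -\Gamma & G\begin{bmatrix}\Gamma\\ Y\end{bmatrix}\\ [\Gamma\ \ Y^\top]G^\top & -\Gamma+\epsilon_\Gamma I_n\end{bmatrix}\preceq 0\qquad\text{for all } G\in\bar{\mathcal{G}},$$ and let $K=Y\Gamma^{-1}$ in the disturbed closed-loop system $$x^{+}=(A(x)+B(x)K)x+w,$$ where $w\in\mathbb{R}^n$ is the disturbance. If the initial state $x(0)$ and the disturbance $w(k)$ satisfy $$|x(0)|^2\le r^2\quad\text{and}\quad \delta_{x_0}|x(0)|^2+\delta_w|w|_\infty^2\le r^2,$$ where $$\delta_{x_0}:=\frac{2\lambda_{\max}^2(\Gamma)-\epsilon_\Gamma\lambda_{\min}(\Gamma)}{2\lambda_{\min}(\Gamma)\lambda_{\max}(\Gamma)},\qquad \delta_w:=\frac{4\gamma_{A_{\rm cl}}^2\lambda_{\max}^5(\Gamma)+2\epsilon_\Gamma\lambda_{\min}(\Gamma)\lambda_{\max}^3(\Gamma)}{\epsilon_\Gamma^2\lambda_{\min}^3(\Gamma)},$$ $$\gamma_{A_{\rm cl}}:=\max_{x\in\mathcal{B}_r}\|A(x)+B(x)K\|,$$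 then there exist $\beta\in\mathcal{KL}$ and $\gamma\in\mathcal{K}$ such that $$|x(k)|\le\beta(|x(0)|,k)+\gamma(|w|_\infty)\qquad\text{for all }k\in\mathbb{N}.$$
   Context: Setting: $\mathbb{X}\subseteq\mathbb{R}^n$ contains the origin; $A(x)=[a_{ij}(x)]_{n\times n}$ and $B(x)=[b_{ij}(x)]_{n\times m}$ are state-dependent matrices whose entries $a_{ij},b_{ij}:\mathbb{X}\to\mathbb{R}$ are continuous. The system is in discrete time: $x^{+}(k)=x(k+1)$, $k\in\mathbb{N}=\{0,1,2,\dots\}$, where $x\in\mathbb{R}^n$ is the state. Notation: $|\cdot|$ is the 2-norm of a vector and $\|\cdot\|$ the induced 2-norm of a matrix; $|w|_\infty=\sup_{k\ge0}|w(k)|$; $\mathcal{B}_r=\{x\in\mathbb{R}^n:|x|\le r\}$; $\lambda_{\max},\lambda_{\min}$ are the largest and smallest eigenvalues of a symmetric matrix; $\succ,\preceq$ denote the Loewner order on symmetric matrices; $I_n$ is the $n\times n$ identity. Vertex set: with $\bar a_{ij}=\max_{x\in\mathcal{B}_r}a_{ij}(x)$, $\underline a_{ij}=\min_{x\in\mathcal{B}_r}a_{ij}(x)$, $\bar b_{ij}=\max_{x\in\mathcal{B}_r}b_{ij}(x)$, $\underline b_{ij}=\min_{x\in\mathcal{B}_r}b_{ij}(x)$, $$\bar{\mathcal{G}}=\Big\{\big[[\alpha_{ij}]_{n\times n}\ \ [\beta_{ij}]_{n\times m}\big]\in\mathbb{R}^{n\times(n+m)}:\alpha_{ij}\in\{\bar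 a_{ij},\underline a_{ij}\},\ \beta_{ij}\in\{\bar b_{ij},\underline b_{ij}\}\Big\}.$$ Comparison functions: $\mathcal{K}$ and $\mathcal{KL}$ are the standard classes of comparison functions: $\gamma:[0,\infty)\to[0,\infty)$ is of class $\mathcal{K}$ if it is continuous, strictly increasing and $\gamma(0)=0$; $\beta:[0,\infty)\times[0,\infty)\to[0,\infty)$ is of class $\mathcal{KL}$ if $\beta(\cdot,t)$ is of class $\mathcal{K}$ for each fixed $t$ and, for each fixed $s>0$, $\beta(s,\cdot)$ is continuous, strictly decreasing and tends to $0$ at infinity. *)

theory Defs
  imports "HOL-Analysis.Analysis"
begin

definition hcat :: "'a^'p^'n \<Rightarrow> 'a^'q^'n \<Rightarrow> 'a^('p + 'q)^'n" where
  "hcat P Q = (\<chi> i j. case j of Inl k \<Rightarrow> P $ i $ k | Inr k \<Rightarrow> Q $ i $ k)"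

definition vcat :: "'a^'n^'p \<Rightarrow> 'a^'n^'q \<Rightarrow> 'a^'n^('p + 'q)" where
  "vcat P Q = (\<chi> i. case i of Inl k \<Rightarrow> P $ k | Inr k \<Rightarrow> Q $ k)"

definition block2 ::
  "'a^'p^'n \<Rightarrow> 'a^'q^'n \<Rightarrow> 'a^'p^'m \<Rightarrow> 'a^'q^'m \<Rightarrow> 'a^('p + 'q)^('n + 'm)" where
  "block2 P Q R S = vcat (hcat P Q) (hcat R S)"

definition symmetric :: "real^'n^'n \<Rightarrow> bool" where
  "symmetric M \<longleftrightarrow> transpose M = M"

definition loewner_le :: "real^'n^'n \<Rightarrow> real^'n^'n \<Rightarrow> bool" where
  "loewner_le P Q \<longleftrightarrow> symmetric P \<and> symmetric Q \<and> (\<forall>v. 0 \<le> v \<bullet> ((Q - P) *v v))"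

definition loewner_less :: "real^'n^'n \<Rightarrow> real^'n^'n \<Rightarrow> bool" where
  "loewner_less P Q \<longleftrightarrow>
     symmetric P \<and> symmetric Q \<and> (\<forall>v. v \<noteq> 0 \<longrightarrow> 0 < v \<bullet> ((Q - P) *v v))"

definition eigenvalue :: "real^'n^'n \<Rightarrow> real \<Rightarrow> bool" where
  "eigenvalue M l \<longleftrightarrow> (\<exists>v. v \<noteq> 0 \<and> M *v v = l *\<^sub>R v)"

definition lambda_max :: "real^'n^'n \<Rightarrow> real" where
  "lambda_max M = (GREATEST l. eigenvalue M l)"

definition lambda_min :: "real^'n^'n \<Rightarrow> real" where
  "lambda_min M = (LEAST l. eigenvalue M l)"

(* Unspecified if the extremum is not attained; below these are applied only to
   functions that are continuous on a closed ball. *)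
definition max_over :: "'a set \<Rightarrow> ('a \<Rightarrow> real) \<Rightarrow> real" where
  "max_over S f = (GREATEST y. y \<in> f ` S)"

definition min_over :: "'a set \<Rightarrow> ('a \<Rightarrow> real) \<Rightarrow> real" where
  "min_over S f = (LEAST y. y \<in> f ` S)"

definition vertex_set ::
  "(real^'n \<Rightarrow> real^'n^'n) \<Rightarrow> (real^'n \<Rightarrow> real^'m^'n) \<Rightarrow> real \<Rightarrow> (real^('n + 'm)^'n) set" where
  "vertex_set A B r =
     {hcat \<alpha> \<beta> | \<alpha> \<beta>.
        (\<forall>i j. \<alpha> $ i $ j \<in> {max_over (cball 0 r) (\<lambda>x. A x $ i $ j),
                           min_over (cball 0 r) (\<lambda>x. A x $ i $ j)}) \<and>
        (\<forall>i j. \<beta> $ i $ j \<in> {max_over (cball 0 r) (\<lambda>x. B x $ i $ j),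
                           min_over (cball 0 r) (\<lambda>x. B x $ i $ j)})}"

(* The induced 2-norm is the operator norm of the associated linear map; norm on
   the matrix type itself would be the Frobenius norm. *)
definition gamma_Acl ::
  "(real^'n \<Rightarrow> real^'n^'n) \<Rightarrow> (real^'n \<Rightarrow> real^'m^'n) \<Rightarrow> real^'n^'m \<Rightarrow> real \<Rightarrow> real" where
  "gamma_Acl A B K r = max_over (cball 0 r) (\<lambda>x. onorm ((*v) (A x + B x ** K)))"

definition delta_x0 :: "real^'n^'n \<Rightarrow> real \<Rightarrow> real" where
  "delta_x0 \<Gamma> \<epsilon> =
     (2 * (lambda_max \<Gamma>)^2 - \<epsilon> * lambda_min \<Gamma>) / (2 * lambda_min \<Gamma> * lambda_max \<Gamma>)"

definition delta_w :: "real^'n^'n \<Rightarrow> real \<Rightarrow> real \<Rightarrow> real" where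
  "delta_w \<Gamma> \<epsilon> g =
     (4 * g^2 * (lambda_max \<Gamma>)^5 + 2 * \<epsilon> * lambda_min \<Gamma> * (lambda_max \<Gamma>)^3)
       / (\<epsilon>^2 * (lambda_min \<Gamma>)^3)"

(* Equals the supremum norm only for bounded sequences. *)
definition sup_norm :: "(nat \<Rightarrow> real^'n) \<Rightarrow> real" where
  "sup_norm w = (SUP k. norm (w k))"

definition class_K :: "(real \<Rightarrow> real) \<Rightarrow> bool" where
  "class_K \<gamma> \<longleftrightarrow>
     \<gamma> \<in> {0..} \<rightarrow> {0..} \<and> continuous_on {0..} \<gamma> \<and> strict_mono_on {0..} \<gamma> \<and> \<gamma> 0 = 0"

definition class_KL :: "(real \<Rightarrow> real \<Rightarrow> real) \<Rightarrow> bool" where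
  "class_KL \<beta> \<longleftrightarrow>
     (\<forall>t\<ge>0. class_K (\<lambda>s. \<beta> s t)) \<and>
     (\<forall>s>0. continuous_on {0..} (\<beta> s) \<and> strict_antimono_on {0..} (\<beta> s) \<and>
            (\<beta> s \<longlongrightarrow> 0) at_top)"

end

(* V(x) = x . Gamma^-1 x is a Lyapunov function: the matrix inequality at [A(x) B(x)], tested on the
   vector (Gamma^-1 M z, Gamma^-1 z) with M = A(x) + B(x) K, gives
   V(M z) <= V(z) - eps |Gamma^-1 z|^2 for x in the ball. Young's inequality then yields
   V(M x + w) <= q V(x) + c |w|^2 with q = 1 - eps lambda_min / (2 lambda_max^2).
   Iterating, |x(k)|^2 <= q^k (lambda_max / lambda_min) |x(0)|^2 + lambda_max c / (1 - q) |w|^2, and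
   delta_x0, delta_w are exactly these coefficients for k = 1, so the trajectory never leaves the
   ball on which the estimate holds. *)

theory Submission
  imports Defs
begin

section \<open>Block matrices\<close>

definition vec_append :: "'a^'p \<Rightarrow> 'a^'q \<Rightarrow> 'a^('p + 'q)" where
  "vec_append u v = (\<chi> i. case i of Inl k \<Rightarrow> u $ k | Inr k \<Rightarrow> v $ k)"

lemma sum_UNIV_Plus:
  "sum f (UNIV :: ('p::finite + 'q::finite) set) = (\<Sum>k\<in>UNIV. f (Inl k)) + (\<Sum>k\<in>UNIV. f (Inr k))"
  using sum.Plus[of UNIV UNIV f] by (simp add: comp_def)

lemma inner_vec_append:
  fixes u u' :: "real^'p" and v v' :: "real^'q"
  shows "vec_append u v \<bullet> vec_append u' v' = u \<bullet> u' + v \<bullet> v'"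
  by (simp add: inner_vec_def sum_UNIV_Plus vec_append_def)

lemma hcat_mult_vec_append: "hcat P Q *v vec_append u v = P *v u + Q *v v"
  by (simp add: vec_eq_iff matrix_vector_mult_def sum_UNIV_Plus hcat_def vec_append_def)

lemma vcat_mult_vec: "vcat P Q *v v = vec_append (P *v v) (Q *v v)"
  by (auto simp: vec_eq_iff matrix_vector_mult_def vcat_def vec_append_def split: sum.split)

lemma hcat_mult_vcat: "hcat P Q ** vcat R S = P ** R + Q ** S"
  by (simp add: vec_eq_iff matrix_matrix_mult_def sum_UNIV_Plus hcat_def vcat_def)

lemma transpose_vcat: "transpose (vcat P Q) = hcat (transpose P) (transpose Q)"
  by (auto simp: vec_eq_iff transpose_def vcat_def hcat_def split: sum.split)

lemma block2_quadratic_form: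
  fixes P :: "real^'p^'p" and Q :: "real^'q^'p" and R :: "real^'p^'q" and S :: "real^'q^'q"
  shows "vec_append u v \<bullet> (block2 P Q R S *v vec_append u v)
       = u \<bullet> (P *v u) + u \<bullet> (Q *v v) + v \<bullet> (R *v u) + v \<bullet> (S *v v)"
  by (simp add: block2_def vcat_mult_vec hcat_mult_vec_append inner_vec_append inner_add_right)

lemma inner_transpose_mult:
  fixes M :: "real^'n^'m"
  shows "v \<bullet> (transpose M *v u) = u \<bullet> (M *v v)"
  by (metis dot_lmul_matrix inner_commute vector_transpose_matrix transpose_transpose)

lemma uminus_matrix_mult_vec: "(- M) *v v = - (M *v v)" for M :: "real^'n^'m"
  using matrix_vector_mult_diff_rdistrib[of 0 M v] by simp

text \<open>Symmetry of \<open>\<Gamma>\<close> makes the two off-diagonal blocks transposes of each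
  other, so their contributions at the test vector \<open>vec_append u v\<close> coincide and merge
  into one doubled cross term. Only that term depends on the vertex.\<close>

lemma block2_lmi_quadratic_form:
  fixes \<Gamma> :: "real^'n^'n" and Y :: "real^'n^'m" and \<alpha> :: "real^'n^'n" and \<beta> :: "real^'m^'n"
  assumes "symmetric \<Gamma>"
    and "loewner_le (block2 (- \<Gamma>) (hcat \<alpha> \<beta> ** vcat \<Gamma> Y)
           (hcat \<Gamma> (transpose Y) ** transpose (hcat \<alpha> \<beta>)) (- \<Gamma> + \<epsilon> *\<^sub>R mat 1)) 0"
  shows "2 * (u \<bullet> (\<alpha> *v (\<Gamma> *v v) + \<beta> *v (Y *v v))) + \<epsilon> * (v \<bullet> v)
           \<le> u \<bullet> (\<Gamma> *v u) + v \<bullet> (\<Gamma> *v v)"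
proof -
  let ?T = "hcat \<alpha> \<beta> ** vcat \<Gamma> Y"
  have T: "hcat \<Gamma> (transpose Y) ** transpose (hcat \<alpha> \<beta>) = transpose ?T"
    using assms(1) by (simp add: matrix_transpose_mul transpose_vcat symmetric_def)
  have Tv: "?T *v v = \<alpha> *v (\<Gamma> *v v) + \<beta> *v (Y *v v)"
    by (simp add: hcat_mult_vcat matrix_vector_mult_add_rdistrib matrix_vector_mul_assoc)
  have "0 \<le> vec_append u v \<bullet> ((0 - block2 (- \<Gamma>) ?T (transpose ?T) (- \<Gamma> + \<epsilon> *\<^sub>R mat 1)) *v vec_append u v)"
    using assms(2) unfolding loewner_le_def T by blast
  then have "0 \<le> - (vec_append u v \<bullet> (block2 (- \<Gamma>) ?T (transpose ?T) (- \<Gamma> + \<epsilon> *\<^sub>R mat 1) *v vec_append u v))"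
    by (simp add: uminus_matrix_mult_vec)
  then show ?thesis
    unfolding block2_quadratic_form inner_transpose_mult Tv
    by (simp add: matrix_vector_mult_diff_rdistrib uminus_matrix_mult_vec inner_add_right
        inner_diff_right flip: scaleR_matrix_vector_assoc)
qed

section \<open>Extremal eigenvalues\<close>

lemma symmetric_inner_swap: "symmetric M \<Longrightarrow> u \<bullet> (M *v v) = v \<bullet> (M *v u)"
  by (metis inner_transpose_mult symmetric_def)

text \<open>Moving \<open>v\<close> against \<open>y = N *v v\<close> turns the form into
  \<open>t^2 * c - 2 * t * (y \<bullet> y)\<close>, which is negative for small \<open>t > 0\<close>
  unless \<open>y = 0\<close>.\<close>

lemma psd_kernel:
  fixes N :: "real^'n^'n"
  assumes sym: "symmetric N" and psd: "\<And>v. 0 \<le> v \<bullet> (N *v v)" and v: "v \<bullet> (N *v v) = 0"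
  shows "N *v v = 0"
proof (rule ccontr)
  define y where "y = N *v v"
  define c where "c = y \<bullet> (N *v y)"
  assume "N *v v \<noteq> 0"
  then have y0: "0 < y \<bullet> y" by (simp add: y_def)
  have c0: "0 \<le> c" unfolding c_def by (rule psd)
  have q: "0 \<le> t^2 * c - 2 * t * (y \<bullet> y)" for t
  proof -
    have "0 \<le> (v - t *\<^sub>R y) \<bullet> (N *v (v - t *\<^sub>R y))" by (rule psd)
    also have "\<dots> = t^2 * c - 2 * t * (y \<bullet> y)"
      using symmetric_inner_swap[OF sym, of v y] v
      by (simp add: matrix_vector_mult_diff_distrib matrix_vector_mult_scaleR inner_diff_left
          inner_diff_right power2_eq_square c_def algebra_simps flip: y_def)
    finally show ?thesis .
  qed
  \<comment> \<open>The \<open>+ 1\<close> covers the case \<open>c = 0\<close>; this choice gives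
    \<open>t * c \<le> y \<bullet> y\<close>, which contradicts the lower bound
    \<open>2 * (y \<bullet> y)\<close>.\<close>
  define t where "t = (y \<bullet> y) / (c + 1)"
  have t0: "0 < t" using y0 c0 by (simp add: t_def)
  have "0 \<le> t * (t * c - 2 * (y \<bullet> y))"
    using q[of t] by (simp add: power2_eq_square algebra_simps)
  then have "2 * (y \<bullet> y) \<le> t * c"
    using t0 by (simp add: zero_le_mult_iff)
  also have "t * c \<le> t * (c + 1)" using t0 by simp
  also have "\<dots> = y \<bullet> y" using c0 by (simp add: t_def)
  finally show False using y0 by simp
qed

text \<open>The form attains its minimum \<open>l\<close> on the compact unit sphere. The shifted
  matrix \<open>M - l I\<close> is then positive semidefinite with vanishing form at the minimiser,
  so \<open>psd_kernel\<close> turns the minimiser into an eigenvector.\<close>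

lemma least_rayleigh_eigenvalue:
  fixes M :: "real^'n^'n"
  assumes sym: "symmetric M"
  obtains l where "eigenvalue M l" "\<And>v. l * (v \<bullet> v) \<le> v \<bullet> (M *v v)"
proof -
  have ne: "sphere (0::real^'n) 1 \<noteq> {}"
    using vector_choose_size[of 1] by auto
  have "continuous_on (sphere 0 1) (\<lambda>v. v \<bullet> (M *v v))"
    by (intro continuous_intros linear_continuous_on matrix_vector_mul_bounded_linear)
  from continuous_attains_inf[OF compact_sphere ne this]
  obtain v0 where v0: "norm v0 = 1" and min: "\<And>v. norm v = 1 \<Longrightarrow> v0 \<bullet> (M *v v0) \<le> v \<bullet> (M *v v)"
    by auto
  define l where "l = v0 \<bullet> (M *v v0)"
  have ray: "l * (v \<bullet> v) \<le> v \<bullet> (M *v v)" for v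
  proof (cases "v = 0")
    case False
    let ?s = "inverse (norm v)"
    have "l \<le> (?s *\<^sub>R v) \<bullet> (M *v (?s *\<^sub>R v))"
      unfolding l_def by (rule min) (use False in simp)
    also have "\<dots> = (v \<bullet> (M *v v)) / (v \<bullet> v)"
      by (simp add: matrix_vector_mult_scaleR dot_square_norm power2_eq_square divide_inverse)
    finally show ?thesis using False by (simp add: pos_le_divide_eq)
  qed simp
  define N where "N = M - l *\<^sub>R mat 1"
  have Nv: "N *v v = M *v v - l *\<^sub>R v" for v
    by (simp add: N_def matrix_vector_mult_diff_rdistrib flip: scaleR_matrix_vector_assoc)
  have "symmetric N"
    using sym by (simp add: symmetric_def N_def transpose_def vec_eq_iff mat_def)
  moreover have "0 \<le> v \<bullet> (N *v v)" for v
    using ray[of v] by (simp add: Nv inner_diff_right)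
  moreover have "v0 \<bullet> (N *v v0) = 0"
    using v0 by (simp add: Nv inner_diff_right l_def dot_square_norm)
  ultimately have "N *v v0 = 0" by (rule psd_kernel)
  then have "eigenvalue M l"
    using v0 unfolding eigenvalue_def by (intro exI[of _ v0]) (auto simp: Nv)
  with ray show thesis using that by blast
qed

lemma eigenvalue_uminus: "eigenvalue (- M) l \<longleftrightarrow> eigenvalue M (- l)"
  by (simp add: eigenvalue_def uminus_matrix_mult_vec neg_eq_iff_add_eq_0 eq_neg_iff_add_eq_0)

text \<open>The \<open>LEAST\<close> in \<open>lambda_min\<close> says something only once a least
  eigenvalue is exhibited. The Rayleigh minimum is one: its inequality, evaluated at any
  eigenvector, bounds the corresponding eigenvalue from below.\<close>

lemma lambda_min_rayleigh:
  assumes "symmetric M"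
  shows "eigenvalue M (lambda_min M)" and "lambda_min M * (v \<bullet> v) \<le> v \<bullet> (M *v v)"
proof -
  obtain l where l: "eigenvalue M l" "\<And>v. l * (v \<bullet> v) \<le> v \<bullet> (M *v v)"
    using least_rayleigh_eigenvalue[OF assms] by blast
  have "lambda_min M = l"
    unfolding lambda_min_def
  proof (rule Least_equality)
    fix m assume "eigenvalue M m"
    then obtain u where u: "u \<noteq> 0" "M *v u = m *\<^sub>R u" by (auto simp: eigenvalue_def)
    then show "l \<le> m" using l(2)[of u] by simp
  qed (fact l)
  then show "eigenvalue M (lambda_min M)" "lambda_min M * (v \<bullet> v) \<le> v \<bullet> (M *v v)"
    using l by auto
qed

lemma lambda_max_rayleigh:
  assumes "symmetric M"
  shows "v \<bullet> (M *v v) \<le> lambda_max M * (v \<bullet> v)"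
proof -
  have "symmetric (- M)"
    using assms by (simp add: symmetric_def transpose_def vec_eq_iff)
  then obtain l where l: "eigenvalue M (- l)" and ray: "\<And>v. v \<bullet> (M *v v) \<le> - l * (v \<bullet> v)"
    using least_rayleigh_eigenvalue[of "- M"]
    by (auto simp: eigenvalue_uminus uminus_matrix_mult_vec) (smt (verit) mult_minus_left)
  have "lambda_max M = - l"
    unfolding lambda_max_def
  proof (rule Greatest_equality)
    fix m assume "eigenvalue M m"
    then obtain u where u: "u \<noteq> 0" "M *v u = m *\<^sub>R u" by (auto simp: eigenvalue_def)
    then have "m * (u \<bullet> u) \<le> - l * (u \<bullet> u)" using ray[of u] by simp
    then show "m \<le> - l" by (rule mult_right_le_imp_le) (use u in simp)
  qed (fact l)
  then show ?thesis using ray by simp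
qed

section \<open>Extrema of continuous functions\<close>

lemma max_over_upper:
  assumes "compact S" "continuous_on S f" "x \<in> S"
  shows "f x \<le> max_over S f"
proof -
  obtain z where z: "z \<in> S" "\<And>y. y \<in> S \<Longrightarrow> f y \<le> f z"
    using continuous_attains_sup[of S f] assms by blast
  have "max_over S f = f z"
    unfolding max_over_def by (rule Greatest_equality) (use z in auto)
  then show ?thesis using z assms by simp
qed

lemma min_over_lower:
  assumes "compact S" "continuous_on S f" "x \<in> S"
  shows "min_over S f \<le> f x"
proof -
  obtain z where z: "z \<in> S" "\<And>y. y \<in> S \<Longrightarrow> f z \<le> f y"
    using continuous_attains_inf[of S f] assms by blast
  have "min_over S f = f z"
    unfolding min_over_def by (rule Least_equality) (use z in auto)
  then show ?thesis using z assms by simp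
qed

text \<open>The operator norm is Lipschitz in the matrix, by the triangle inequality and an
  entrywise bound; the constant is crude because only continuity matters. This is what makes the
  maximum in \<open>gamma_Acl\<close> attained.\<close>

lemma continuous_on_onorm_matrix:
  fixes M :: "'a::topological_space \<Rightarrow> real^'m^'n"
  assumes "continuous_on S M"
  shows "continuous_on S (\<lambda>x. onorm ((*v) (M x)))"
proof -
  let ?C = "real (CARD('n)) * real (CARD('m))"
  have bd: "onorm ((*v) P) \<le> onorm ((*v) Q) + ?C * norm (P - Q)" for P Q :: "real^'m^'n"
  proof -
    have "onorm ((*v) P) = onorm (\<lambda>v. Q *v v + (P - Q) *v v)"
      by (simp add: matrix_vector_mult_diff_rdistrib)
    also have "\<dots> \<le> onorm ((*v) Q) + onorm ((*v) (P - Q))"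
      by (rule onorm_triangle) auto
    also have "onorm ((*v) (P - Q)) \<le> (\<Sum>i\<in>UNIV. \<Sum>j\<in>UNIV. \<bar>(P - Q) $ i $ j\<bar>)"
      by (rule onorm_le_matrix_component_sum)
    also have "\<dots> \<le> (\<Sum>i\<in>(UNIV::'n set). \<Sum>j\<in>(UNIV::'m set). norm (P - Q))"
      by (intro sum_mono order_trans[OF component_le_norm_cart] Finite_Cartesian_Product.norm_nth_le)
    finally show ?thesis by (simp add: mult.assoc)
  qed
  have "?C-lipschitz_on UNIV (\<lambda>P :: real^'m^'n. onorm ((*v) P))"
  proof (rule lipschitz_onI)
    show "dist (onorm ((*v) P)) (onorm ((*v) Q)) \<le> ?C * dist P Q" for P Q :: "real^'m^'n"
      using bd[of P Q] bd[of Q P] by (simp add: dist_norm norm_minus_commute abs_le_iff)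
  qed simp
  then have "continuous_on UNIV (\<lambda>P :: real^'m^'n. onorm ((*v) P))"
    by (rule lipschitz_on_continuous_on)
  then show ?thesis
    using continuous_on_compose2[OF _ assms] by blast
qed

text \<open>Replaces a convex-hull argument: only the cross term of the block form depends on \<open>[A B]\<close>, and
  for each test vector the vertex maximising it is chosen entrywise by sign.\<close>

lemma bilinear_le_extremal_matrix:
  fixes C :: "real^'m^'n"
  assumes "\<And>i j. lo i j \<le> C $ i $ j" "\<And>i j. C $ i $ j \<le> hi i j"
  obtains D :: "real^'m^'n" where "\<And>i j. D $ i $ j \<in> {hi i j, lo i j}" "u \<bullet> (C *v z) \<le> u \<bullet> (D *v z)"
proof
  let ?D = "(\<chi> i j. if 0 \<le> u $ i * z $ j then hi i j else lo i j) :: real^'m^'n"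
  show "?D $ i $ j \<in> {hi i j, lo i j}" for i j by simp
  have *: "c * s \<le> (if 0 \<le> s then h else l) * s" if "l \<le> c" "c \<le> h" for c s h l :: real
    using that by (auto intro: mult_right_mono mult_right_mono_neg)
  have "u $ i * (C $ i $ j * z $ j) \<le> u $ i * (?D $ i $ j * z $ j)" for i j
    using *[OF assms(1)[of i j] assms(2)[of i j], of "u $ i * z $ j"] by (simp add: mult_ac)
  then show "u \<bullet> (C *v z) \<le> u \<bullet> (?D *v z)"
    by (simp add: inner_vec_def matrix_vector_mult_def sum_distrib_left sum_mono)
qed

text \<open>For fixed \<open>x\<close>, \<open>u\<close> and \<open>v\<close>, the vertex blocks are
  chosen separately: \<alpha> against the vector \<open>\<Gamma> *v v\<close> and \<beta> against
  \<open>Y *v v\<close>. The chosen vertex varies with the test vectors, but the resulting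
  inequality no longer mentions it.\<close>

lemma lmi_on_ball:
  fixes A :: "real^'n \<Rightarrow> real^'n^'n" and B :: "real^'n \<Rightarrow> real^'m^'n"
  assumes cA: "\<And>i j. continuous_on (cball 0 r) (\<lambda>x. A x $ i $ j)"
    and cB: "\<And>i j. continuous_on (cball 0 r) (\<lambda>x. B x $ i $ j)"
    and sym: "symmetric \<Gamma>"
    and lmi: "\<And>G. G \<in> vertex_set A B r \<Longrightarrow>
           loewner_le
             (block2 (- \<Gamma>) (G ** vcat \<Gamma> Y)
                     (hcat \<Gamma> (transpose Y) ** transpose G) (- \<Gamma> + \<epsilon> *\<^sub>R mat 1)) 0"
    and x: "x \<in> cball 0 r"
  shows "2 * (u \<bullet> (A x *v (\<Gamma> *v v) + B x *v (Y *v v))) + \<epsilon> * (v \<bullet> v)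
           \<le> u \<bullet> (\<Gamma> *v u) + v \<bullet> (\<Gamma> *v v)"
proof -
  obtain \<alpha> :: "real^'n^'n" where
    a: "\<And>i j. \<alpha> $ i $ j \<in> {max_over (cball 0 r) (\<lambda>x. A x $ i $ j), min_over (cball 0 r) (\<lambda>x. A x $ i $ j)}"
       "u \<bullet> (A x *v (\<Gamma> *v v)) \<le> u \<bullet> (\<alpha> *v (\<Gamma> *v v))"
    using bilinear_le_extremal_matrix[of "\<lambda>i j. min_over (cball 0 r) (\<lambda>x. A x $ i $ j)" "A x"
        "\<lambda>i j. max_over (cball 0 r) (\<lambda>x. A x $ i $ j)" u "\<Gamma> *v v"]
      min_over_lower[OF compact_cball cA x] max_over_upper[OF compact_cball cA x] by blast
  obtain \<beta> :: "real^'m^'n" where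
    b: "\<And>i j. \<beta> $ i $ j \<in> {max_over (cball 0 r) (\<lambda>x. B x $ i $ j), min_over (cball 0 r) (\<lambda>x. B x $ i $ j)}"
       "u \<bullet> (B x *v (Y *v v)) \<le> u \<bullet> (\<beta> *v (Y *v v))"
    using bilinear_le_extremal_matrix[of "\<lambda>i j. min_over (cball 0 r) (\<lambda>x. B x $ i $ j)" "B x"
        "\<lambda>i j. max_over (cball 0 r) (\<lambda>x. B x $ i $ j)" u "Y *v v"]
      min_over_lower[OF compact_cball cB x] max_over_upper[OF compact_cball cB x] by blast
  have "hcat \<alpha> \<beta> \<in> vertex_set A B r"
    unfolding vertex_set_def using a(1) b(1) by blast
  from block2_lmi_quadratic_form[OF sym lmi[OF this], of u v] a(2) b(2)
  show ?thesis by (simp add: inner_add_right)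
qed

section \<open>The Lyapunov function\<close>

locale lyapunov_matrix =
  fixes \<Gamma> :: "real^'n^'n"
  assumes sym: "symmetric \<Gamma>" and pos: "loewner_less 0 \<Gamma>"
begin

abbreviation "l \<equiv> lambda_min \<Gamma>"
abbreviation "L \<equiv> lambda_max \<Gamma>"
definition "P = matrix_inv \<Gamma>"
definition "V x = x \<bullet> (P *v x)"

lemma lambda_min_pos: "0 < l"
proof -
  obtain v where v: "v \<noteq> 0" "\<Gamma> *v v = l *\<^sub>R v"
    using lambda_min_rayleigh(1)[OF sym] by (auto simp: eigenvalue_def)
  then have "0 < v \<bullet> (\<Gamma> *v v)" using pos by (auto simp: loewner_less_def)
  then show ?thesis using v inner_ge_zero[of v] by (auto simp: zero_less_mult_iff)
qed

lemma lambda_min_le_max: "l \<le> L"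
proof -
  obtain v :: "real^'n" where "norm v = 1" using vector_choose_size[of 1] by auto
  then show ?thesis
    using lambda_min_rayleigh(2)[OF sym, of v] lambda_max_rayleigh[OF sym, of v]
    by (simp add: dot_square_norm)
qed

lemma lambda_max_pos: "0 < L"
  using lambda_min_pos lambda_min_le_max by linarith

lemma inverse_mult: "\<Gamma> *v (P *v x) = x" "P *v (\<Gamma> *v x) = x"
proof -
  have "\<forall>x. \<Gamma> *v x = 0 \<longrightarrow> x = 0"
    using pos unfolding loewner_less_def by force
  then have "invertible \<Gamma>"
    using invertible_left_inverse matrix_left_invertible_ker by blast
  \<comment> \<open>\<open>matrix_inv\<close> is a Hilbert choice, so invertibility is what turns it
    into a two-sided inverse.\<close>
  then have "\<Gamma> ** P = mat 1 \<and> P ** \<Gamma> = mat 1"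
    unfolding P_def invertible_def matrix_inv_def by (rule someI_ex)
  then show "\<Gamma> *v (P *v x) = x" "P *v (\<Gamma> *v x) = x"
    by (simp_all add: matrix_vector_mul_assoc)
qed

lemma P_inner_swap: "x \<bullet> (P *v y) = y \<bullet> (P *v x)"
  using symmetric_inner_swap[OF sym, of "P *v x" "P *v y"]
  by (simp add: inverse_mult inner_commute)

lemma V_eq_form: "V x = (P *v x) \<bullet> (\<Gamma> *v (P *v x))"
  by (simp add: V_def inverse_mult inner_commute)

text \<open>This is the Loewner bound \<open>P \<ge> I / L\<close>, obtained without the spectrum of
  \<open>P\<close>: the form of \<Gamma> at \<open>P *v x - x / L\<close> is nonnegative, its cross
  term simplifies because \<Gamma> cancels \<open>P\<close>, and its last term is bounded through
  \<open>L\<close>.\<close>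

lemma norm_le_V: "(norm x)^2 \<le> L * V x"
proof -
  let ?y = "P *v x" and ?t = "inverse L"
  have "0 \<le> l * ((?y - ?t *\<^sub>R x) \<bullet> (?y - ?t *\<^sub>R x))"
    using lambda_min_pos by simp
  also have "\<dots> \<le> (?y - ?t *\<^sub>R x) \<bullet> (\<Gamma> *v (?y - ?t *\<^sub>R x))"
    by (rule lambda_min_rayleigh(2)[OF sym])
  also have "\<dots> = V x - 2 * ?t * (x \<bullet> x) + ?t^2 * (x \<bullet> (\<Gamma> *v x))"
    using symmetric_inner_swap[OF sym, of ?y x]
    by (simp add: matrix_vector_mult_diff_distrib matrix_vector_mult_scaleR inner_diff_left
        inner_diff_right inverse_mult V_def power2_eq_square inner_commute algebra_simps)
  also have "\<dots> \<le> V x - 2 * ?t * (x \<bullet> x) + ?t^2 * (L * (x \<bullet> x))"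
    by (intro add_left_mono mult_left_mono lambda_max_rayleigh[OF sym]) simp
  also have "\<dots> = V x - (x \<bullet> x) / L"
    using lambda_max_pos by (simp add: power2_eq_square field_simps)
  finally show ?thesis
    using lambda_max_pos by (simp add: dot_square_norm field_simps)
qed

lemma norm_P_mult_le: "norm (P *v x) \<le> norm x / l"
proof (cases "P *v x = 0")
  case False
  have "l * (norm (P *v x))^2 \<le> V x"
    using lambda_min_rayleigh(2)[OF sym, of "P *v x"] by (simp add: V_eq_form dot_square_norm)
  also have "\<dots> \<le> norm x * norm (P *v x)"
    unfolding V_def by (rule norm_cauchy_schwarz)
  finally have "(l * norm (P *v x)) * norm (P *v x) \<le> norm x * norm (P *v x)"
    by (simp add: power2_eq_square mult_ac)
  then show ?thesis
    using False lambda_min_pos by (simp add: field_simps)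
qed (use lambda_min_pos in simp)

lemma inner_P_le: "x \<bullet> (P *v y) \<le> norm x * norm y / l"
  using norm_cauchy_schwarz[of x "P *v y"] mult_left_mono[OF norm_P_mult_le, of "norm x" y]
  by simp

lemma V_le_norm: "V x \<le> (norm x)^2 / l"
  using inner_P_le[of x x] by (simp add: V_def power2_eq_square)

text \<open>Turns the decrease, which the matrix inequality supplies in terms of
  \<open>P *v x\<close>, into a decrease in terms of \<open>x\<close>.\<close>

lemma norm_le_norm_P_mult: "norm x / L \<le> norm (P *v x)"
proof (cases "x = 0")
  case False
  have "(norm x)^2 \<le> L * V x" by (rule norm_le_V)
  also have "\<dots> \<le> L * (norm x * norm (P *v x))"
    unfolding V_def using lambda_max_pos by (intro mult_left_mono norm_cauchy_schwarz) simp
  finally have "norm x * norm x \<le> (L * norm (P *v x)) * norm x"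
    by (simp add: power2_eq_square mult_ac)
  then show ?thesis using False lambda_max_pos by (simp add: field_simps)
qed simp

section \<open>One-step decrease and invariance of the ball\<close>

definition "rate \<epsilon> = 1 - \<epsilon> * l / (2 * L^2)"

definition "gain \<epsilon> g = 2 * g^2 * L^2 / (\<epsilon> * l^2) + 1 / l"

lemma V_nominal_step:
  assumes "\<And>u v. 2 * (u \<bullet> (M *v (\<Gamma> *v v))) + \<epsilon> * (v \<bullet> v) \<le> u \<bullet> (\<Gamma> *v u) + v \<bullet> (\<Gamma> *v v)"
    and "0 < \<epsilon>"
  shows "V (M *v x) \<le> V x - \<epsilon> / L^2 * (norm x)^2"
proof -
  have "V (M *v x) \<le> V x - \<epsilon> * (norm (P *v x))^2"
    \<comment> \<open>With these test vectors the cross term is \<open>2 * V (M *v x)\<close> and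
      the first term on the right is \<open>V (M *v x)\<close>, so one copy cancels.\<close>
    using assms(1)[of "P *v (M *v x)" "P *v x"]
    by (simp add: inverse_mult V_def inner_commute dot_square_norm)
  moreover have "(norm x / L)^2 \<le> (norm (P *v x))^2"
    using norm_le_norm_P_mult lambda_max_pos by (intro power_mono) auto
  then have "\<epsilon> * (norm x / L)^2 \<le> \<epsilon> * (norm (P *v x))^2"
    using assms(2) by simp
  ultimately show ?thesis by (simp add: power_divide)
qed

text \<open>Half of the nominal decrease pays for the cross term between \<open>M *v x\<close> and
  \<open>w\<close>; the other half becomes the contraction factor \<open>rate\<close> through
  \<open>V_le_norm\<close>. The two summands of \<open>gain\<close> are the remainder of the cross
  term and the bound on \<open>V w\<close>.\<close>

lemma V_disturbed_step:
  assumes lmi: "\<And>u v. 2 * (u \<bullet> (M *v (\<Gamma> *v v))) + \<epsilon> * (v \<bullet> v) \<le> u \<bullet> (\<Gamma> *v u) + v \<bullet> (\<Gamma> *v v)"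
    and e: "0 < \<epsilon>" and g: "norm (M *v x) \<le> g * norm x" and w: "norm w \<le> W"
  shows "V (M *v x + w) \<le> rate \<epsilon> * V x + gain \<epsilon> g * W^2"
proof -
  note l0 = lambda_min_pos and L0 = lambda_max_pos
  let ?z = "M *v x"
  define a where "a = norm x"
  have V: "V (?z + w) = V ?z + 2 * (?z \<bullet> (P *v w)) + V w"
    using P_inner_swap[of ?z w]
    by (simp add: V_def matrix_vector_right_distrib inner_add_left inner_add_right)
  have "?z \<bullet> (P *v w) \<le> norm ?z * norm w / l" by (rule inner_P_le)
  also have "\<dots> \<le> g * a * norm w / l"
    using g l0 by (intro divide_right_mono mult_right_mono) (auto simp: a_def)
  finally have cross: "2 * (?z \<bullet> (P *v w)) \<le> 2 * (g * a * norm w / l)" by simp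
  \<comment> \<open>Young's inequality\<close>
  have "0 \<le> (\<epsilon> * l * a - 2 * g * L^2 * norm w)^2 / (2 * \<epsilon> * L^2 * l^2)"
    using e by (intro divide_nonneg_nonneg) auto
  also have "\<dots> = \<epsilon> / (2 * L^2) * a^2 + 2 * g^2 * L^2 / (\<epsilon> * l^2) * (norm w)^2 - 2 * (g * a * norm w / l)"
    using e l0 L0 by (simp add: power2_eq_square field_simps)
  finally have young: "2 * (g * a * norm w / l)
      \<le> \<epsilon> / (2 * L^2) * a^2 + 2 * g^2 * L^2 / (\<epsilon> * l^2) * (norm w)^2" by simp
  have "l * V x \<le> a^2"
    using V_le_norm[of x] l0 by (simp add: a_def field_simps)
  then have "\<epsilon> / (2 * L^2) * (l * V x) \<le> \<epsilon> / (2 * L^2) * a^2"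
    using e by (intro mult_left_mono) auto
  then have q: "V x - \<epsilon> / (2 * L^2) * a^2 \<le> rate \<epsilon> * V x"
    by (simp add: rate_def algebra_simps)
  have "V (?z + w) \<le> V x - \<epsilon> / L^2 * a^2 + (\<epsilon> / (2 * L^2) * a^2 + 2 * g^2 * L^2 / (\<epsilon> * l^2) * (norm w)^2)
      + (norm w)^2 / l"
    using V cross young V_le_norm[of w] V_nominal_step[OF lmi e, of x] by (simp add: a_def)
  also have "\<dots> = V x - \<epsilon> / (2 * L^2) * a^2 + gain \<epsilon> g * (norm w)^2"
    by (simp add: gain_def field_simps)
  also have "\<dots> \<le> rate \<epsilon> * V x + gain \<epsilon> g * W^2"
    using w e l0 by (intro add_mono q mult_left_mono power_mono) (auto simp: gain_def)
  finally show ?thesis .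
qed

text \<open>The hypothesis is the lower diagonal block of the matrix inequality. It forces
  \<open>\<epsilon> \<le> L\<close>, hence \<open>\<epsilon> * l \<le> L^2\<close>, which keeps the
  contraction factor positive.\<close>

lemma rate_bounds:
  assumes "\<And>v. \<epsilon> * (v \<bullet> v) \<le> v \<bullet> (\<Gamma> *v v)" "0 < \<epsilon>"
  shows "0 < rate \<epsilon>" "rate \<epsilon> < 1"
proof -
  obtain v :: "real^'n" where v: "norm v = 1" using vector_choose_size[of 1] by auto
  have "\<epsilon> \<le> L"
    using assms(1)[of v] lambda_max_rayleigh[OF sym, of v] v by (simp add: dot_square_norm)
  then have "\<epsilon> * l \<le> L * L"
    using lambda_min_le_max lambda_min_pos assms(2) by (intro mult_mono) auto
  moreover have "0 < L * L" using lambda_max_pos by simp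
  ultimately have "\<epsilon> * l < 2 * L^2"
    unfolding power2_eq_square by linarith
  then show "0 < rate \<epsilon>" using lambda_max_pos by (simp add: rate_def)
  show "rate \<epsilon> < 1" using lambda_max_pos lambda_min_pos assms(2) by (simp add: rate_def)
qed

text \<open>The factor \<open>gain / (1 - rate)\<close> sums the geometric series of disturbance
  contributions, and \<open>L\<close> converts the bound on \<open>V\<close> into one on the squared
  norm.\<close>

lemma delta_w_eq: "0 < \<epsilon> \<Longrightarrow> delta_w \<Gamma> \<epsilon> g = L * gain \<epsilon> g / (1 - rate \<epsilon>)"
  using lambda_min_pos lambda_max_pos
  by (simp add: delta_w_def rate_def gain_def divide_simps) (simp add: algebra_simps eval_nat_numeral)

lemma delta_x0_eq: "delta_x0 \<Gamma> \<epsilon> = rate \<epsilon> * (L / l)"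
  using lambda_min_pos lambda_max_pos
  by (simp add: delta_x0_def rate_def divide_simps) (simp add: algebra_simps eval_nat_numeral)

text \<open>The second summand of the numerator is positive even if \<open>g = 0\<close>. Strict
  positivity is needed for the slope of a class K function.\<close>

lemma delta_w_pos: "0 < \<epsilon> \<Longrightarrow> 0 < delta_w \<Gamma> \<epsilon> g"
  using lambda_min_pos lambda_max_pos
  by (auto simp: delta_w_def intro!: divide_pos_pos add_nonneg_pos)

text \<open>The decrease is available only inside the ball, and staying inside follows from the
  accumulated decrease, so both claims go through one induction. The base case needs its own
  hypothesis on \<open>x 0\<close>: at \<open>k = 0\<close> the coefficient is \<open>L / l\<close>,
  which exceeds \<open>delta_x0\<close>.\<close>

lemma trajectory_bound:
  fixes x w :: "nat \<Rightarrow> real^'n"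
  assumes step: "\<And>k. norm (x k) \<le> r \<Longrightarrow> V (x (Suc k)) \<le> rate \<epsilon> * V (x k) + gain \<epsilon> g * W^2"
    and e: "0 < \<epsilon>" and rate: "0 < rate \<epsilon>" "rate \<epsilon> < 1"
    and r: "0 < r" "norm (x 0) \<le> r"
    and init: "delta_x0 \<Gamma> \<epsilon> * (norm (x 0))^2 + delta_w \<Gamma> \<epsilon> g * W^2 \<le> r^2"
  shows "(norm (x k))^2 \<le> rate \<epsilon> ^ k * (L / l) * (norm (x 0))^2 + delta_w \<Gamma> \<epsilon> g * W^2"
proof -
  note l0 = lambda_min_pos and L0 = lambda_max_pos
  let ?q = "rate \<epsilon>" and ?c = "gain \<epsilon> g * W^2"
  have c0: "0 \<le> ?c" using e l0 by (simp add: gain_def)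
  have bound: "(norm (x k))^2 \<le> ?q ^ k * (L / l) * (norm (x 0))^2 + delta_w \<Gamma> \<epsilon> g * W^2"
    if "V (x k) \<le> ?q ^ k * V (x 0) + ?c / (1 - ?q)" for k
  proof -
    have "?q ^ k * V (x 0) \<le> ?q ^ k * ((norm (x 0))^2 / l)"
      using rate by (intro mult_left_mono V_le_norm) simp
    then have "L * V (x k) \<le> L * (?q ^ k * ((norm (x 0))^2 / l) + ?c / (1 - ?q))"
      using that L0 by (intro mult_left_mono) auto
    then show ?thesis
      using norm_le_V[of "x k"] by (simp add: delta_w_eq[OF e] algebra_simps)
  qed
  have "V (x k) \<le> ?q ^ k * V (x 0) + ?c / (1 - ?q) \<and> norm (x k) \<le> r" for k
  proof (induction k)
    case 0
    then show ?case using r c0 rate by simp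
  next
    case (Suc k)
    have "V (x (Suc k)) \<le> ?q * V (x k) + ?c" using step Suc by blast
    also have "\<dots> \<le> ?q * (?q ^ k * V (x 0) + ?c / (1 - ?q)) + ?c"
      using Suc rate by (intro add_right_mono mult_left_mono) auto
    also have "\<dots> = ?q ^ Suc k * V (x 0) + ?c / (1 - ?q)"
      using rate by (simp add: divide_simps) (simp add: algebra_simps)
    finally have V: "V (x (Suc k)) \<le> ?q ^ Suc k * V (x 0) + ?c / (1 - ?q)" .
    \<comment> \<open>From the first step on, the power is at most \<open>rate\<close>, so the
      coefficient of the initial state is at most \<open>delta_x0\<close> and \<open>init\<close>
      applies.\<close>
    have "?q ^ Suc k \<le> ?q" using rate power_decreasing[of 1 "Suc k" ?q] by simp
    then have "?q ^ Suc k * (L / l) * (norm (x 0))^2 \<le> delta_x0 \<Gamma> \<epsilon> * (norm (x 0))^2"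
      unfolding delta_x0_eq using l0 L0 by (intro mult_right_mono) auto
    then have "(norm (x (Suc k)))^2 \<le> r^2"
      using bound[OF V] init by linarith
    then have "norm (x (Suc k)) \<le> r" using r by (simp add: power2_le_iff_abs_le)
    with V show ?case by blast
  qed
  then show ?thesis using bound by blast
qed

end

section \<open>Comparison functions\<close>

lemma class_K_linear: "0 < c \<Longrightarrow> class_K (\<lambda>s. c * s)"
  by (auto simp: class_K_def strict_mono_on_def intro!: continuous_intros)

text \<open>The time argument of a class KL function is real, hence \<open>powr\<close> instead of a
  natural power.\<close>

lemma class_KL_exponential:
  assumes "0 < c" "0 < q" "q < 1"
  shows "class_KL (\<lambda>s t. c * q powr t * s)"
  unfolding class_KL_def
proof (intro conjI allI impI)
  fix s :: real assume s: "0 < s"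
  show "continuous_on {0..} (\<lambda>t. c * q powr t * s)"
    using assms by (intro continuous_intros) auto
  show "strict_antimono_on {0..} (\<lambda>t. c * q powr t * s)"
    using assms s by (auto simp: monotone_on_def intro!: powr_less_mono')
  have "((\<lambda>t. q powr t) \<longlongrightarrow> 0) at_top"
  proof -
    have "filterlim (\<lambda>t. ln q * t) at_bot at_top"
      using assms by (intro filterlim_tendsto_neg_mult_at_bot[OF tendsto_const] filterlim_ident) simp
    then have "((\<lambda>t. exp (ln q * t)) \<longlongrightarrow> 0) at_top"
      by (rule filterlim_compose[OF exp_at_bot])
    then show ?thesis using assms by (simp add: powr_def mult.commute)
  qed
  then show "((\<lambda>t. c * q powr t * s) \<longlongrightarrow> 0) at_top"
    by (intro tendsto_mult_left_zero tendsto_mult_right_zero)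
qed (use assms in \<open>simp add: class_K_linear\<close>)

text \<open>Boundedness is what makes the \<open>SUP\<close> an actual upper bound.\<close>

lemma norm_le_sup_norm: "bounded (range w) \<Longrightarrow> norm (w k) \<le> sup_norm w"
  unfolding sup_norm_def by (rule cSUP_upper) (auto simp: bounded_iff bdd_above_def)

section \<open>Input-to-state stability of the closed loop\<close>

theorem theorem2:
  fixes X :: "(real^'n) set"
    and A :: "real^'n \<Rightarrow> real^'n^'n"
    and B :: "real^'n \<Rightarrow> real^'m^'n"
    and r \<epsilon> :: real
    and \<Gamma> :: "real^'n^'n"
    and Y K :: "real^'n^'m"
  assumes "0 \<in> X"
    and "\<And>i j. continuous_on X (\<lambda>x. A x $ i $ j)"
    and "\<And>i j. continuous_on X (\<lambda>x. B x $ i $ j)"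
    and "r > 0"
    and "cball 0 r \<subseteq> X"
    and "symmetric \<Gamma>"
    and "loewner_less 0 \<Gamma>"
    and "\<epsilon> > 0"
    and "\<And>G. G \<in> vertex_set A B r \<Longrightarrow>
           loewner_le
             (block2 (- \<Gamma>)                                   (G ** vcat \<Gamma> Y)
                     (hcat \<Gamma> (transpose Y) ** transpose G)   (- \<Gamma> + \<epsilon> *\<^sub>R mat 1))
             0"
    and "K = Y ** matrix_inv \<Gamma>"
  shows "\<exists>\<beta> \<gamma>. class_KL \<beta> \<and> class_K \<gamma> \<and>
           (\<forall>x w :: nat \<Rightarrow> real^'n.
              (\<forall>k. x (Suc k) = (A (x k) + B (x k) ** K) *v x k + w k) \<longrightarrow>
              bounded (range w) \<longrightarrow>
              (norm (x 0))^2 \<le> r^2 \<longrightarrow>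
              delta_x0 \<Gamma> \<epsilon> * (norm (x 0))^2
                + delta_w \<Gamma> \<epsilon> (gamma_Acl A B K r) * (sup_norm w)^2 \<le> r^2 \<longrightarrow>
              (\<forall>k. norm (x k) \<le> \<beta> (norm (x 0)) (real k) + \<gamma> (sup_norm w)))"
proof -
  interpret lyapunov_matrix \<Gamma>
    using assms by unfold_locales
  define g where "g = gamma_Acl A B K r"
  define M where "M x = A x + B x ** K" for x
  note e = \<open>\<epsilon> > 0\<close>
  have cA: "continuous_on (cball 0 r) (\<lambda>x. A x $ i $ j)" for i j
    using assms(2,5) continuous_on_subset by blast
  have cB: "continuous_on (cball 0 r) (\<lambda>x. B x $ i $ j)" for i j
    using assms(3,5) continuous_on_subset by blast
  \<comment> \<open>Undoes the change of variables \<open>Y = K \<Gamma>\<close>, so that the matrix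
    inequality speaks of the closed-loop matrix.\<close>
  have KG: "K *v (\<Gamma> *v v) = Y *v v" for v
    using inverse_mult(2)[of v] by (simp add: assms(10) P_def flip: matrix_vector_mul_assoc)
  have lmi: "2 * (u \<bullet> (M x *v (\<Gamma> *v v))) + \<epsilon> * (v \<bullet> v) \<le> u \<bullet> (\<Gamma> *v u) + v \<bullet> (\<Gamma> *v v)"
    if "x \<in> cball 0 r" for x u v
    using lmi_on_ball[OF cA cB sym assms(9) that, of u v]
    by (simp add: M_def matrix_vector_mult_add_rdistrib KG flip: matrix_vector_mul_assoc)
  \<comment> \<open>Taking \<open>u = 0\<close> at the centre of the ball isolates the lower
    diagonal block.\<close>
  have "\<epsilon> * (v \<bullet> v) \<le> v \<bullet> (\<Gamma> *v v)" for v
    using lmi[of 0 0 v] \<open>r > 0\<close> by simp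
  note rate = rate_bounds[OF this e]
  have "continuous_on (cball 0 r) (\<lambda>x. M x $ i $ j)" for i j
    unfolding M_def matrix_matrix_mult_def by (simp, intro continuous_intros cA cB)
  then have "continuous_on (cball 0 r) (\<lambda>x. \<chi> i j. M x $ i $ j)"
    by (intro continuous_on_vec_lambda)
  then have cM: "continuous_on (cball 0 r) (\<lambda>x. onorm ((*v) (M x)))"
    by (intro continuous_on_onorm_matrix) simp
  have gM: "norm (M x *v x) \<le> g * norm x" if "x \<in> cball 0 r" for x
  proof -
    have "norm (M x *v x) \<le> onorm ((*v) (M x)) * norm x"
      by (rule onorm) auto
    also have "onorm ((*v) (M x)) \<le> g"
      using max_over_upper[OF compact_cball cM that] by (simp add: g_def gamma_Acl_def M_def)
    finally show ?thesis by (simp add: mult_right_mono)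
  qed
  \<comment> \<open>The trajectory bound concerns squared norms, so its coefficients enter under
    square roots. Both functions are fixed before any trajectory or disturbance is chosen.\<close>
  define \<beta> where "\<beta> = (\<lambda>s t. sqrt (L / l) * sqrt (rate \<epsilon>) powr t * s)"
  define \<gamma> where "\<gamma> = (\<lambda>s. sqrt (delta_w \<Gamma> \<epsilon> g) * s)"
  have "class_KL \<beta>"
    unfolding \<beta>_def using rate lambda_min_pos lambda_max_pos
    by (intro class_KL_exponential) auto
  moreover have "class_K \<gamma>"
    unfolding \<gamma>_def using delta_w_pos[OF e] by (intro class_K_linear) simp
  moreover have "norm (x k) \<le> \<beta> (norm (x 0)) (real k) + \<gamma> (sup_norm w)"
    if dyn: "\<forall>k. x (Suc k) = M (x k) *v x k + w k" and bd: "bounded (range w)"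
      and x0: "(norm (x 0))^2 \<le> r^2"
      and init: "delta_x0 \<Gamma> \<epsilon> * (norm (x 0))^2 + delta_w \<Gamma> \<epsilon> g * (sup_norm w)^2 \<le> r^2"
    for x w :: "nat \<Rightarrow> real^'n" and k
  proof -
    have W0: "0 \<le> sup_norm w"
      using norm_le_sup_norm[OF bd, of 0] norm_ge_zero order_trans by blast
    \<comment> \<open>The one-step lemma concerns a constant matrix; it is applied with the
      closed-loop matrix frozen at the current state \<open>x j\<close>.\<close>
    have "V (x (Suc j)) \<le> rate \<epsilon> * V (x j) + gain \<epsilon> g * (sup_norm w)^2" if "norm (x j) \<le> r" for j
      using that dyn V_disturbed_step[OF lmi e gM norm_le_sup_norm[OF bd, of j], of "x j"] by simp
    from trajectory_bound[OF this e rate \<open>r > 0\<close> _ init, of k] x0 \<open>r > 0\<close>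
    have "(norm (x k))^2 \<le> rate \<epsilon> ^ k * (L / l) * (norm (x 0))^2 + delta_w \<Gamma> \<epsilon> g * (sup_norm w)^2"
      by (simp add: power2_le_iff_abs_le)
    also have "\<dots> = (\<beta> (norm (x 0)) (real k))^2 + (\<gamma> (sup_norm w))^2"
    proof -
      have "(sqrt (rate \<epsilon>) powr real k)^2 = rate \<epsilon> ^ k"
        using rate by (simp add: powr_realpow flip: real_sqrt_power)
      then show ?thesis
        using lambda_min_pos lambda_max_pos delta_w_pos[OF e, of g]
        by (simp add: \<beta>_def \<gamma>_def power_mult_distrib)
    qed
    also have "\<dots> \<le> (\<beta> (norm (x 0)) (real k) + \<gamma> (sup_norm w))^2"
    proof -
      have "0 \<le> \<beta> (norm (x 0)) (real k)" "0 \<le> \<gamma> (sup_norm w)"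
        using lambda_min_pos lambda_max_pos W0 delta_w_pos[OF e, of g] by (simp_all add: \<beta>_def \<gamma>_def)
      then show ?thesis by (simp add: power2_sum)
    qed
    finally show ?thesis
      using lambda_min_pos lambda_max_pos W0 delta_w_pos[OF e, of g]
      by (elim power2_le_imp_le) (simp add: \<beta>_def \<gamma>_def)
  qed
  ultimately show ?thesis
    unfolding M_def g_def by blast
qed

end
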